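(* Suppose that $h$ is a $\mathcal{C}^1$-function with respect to $\theta$ and that the loss function $l$ is a $\mathcal{C}^1$ convex function. Let $\mu_*\in\mathcal{P}$ be a probability measure having a continuous density function. If $\mathrm{supp}(\mu_* )$ is a compact $\mathcal{C}^\infty$-manifold with boundary and $\mu_*$ satisfies $$\|\mathbb{E}_S[s_{\mu_*}(\theta,x,y)]\|_{L^2(\mu_* )}=0,$$ then: (1) there is no probability measure $\mu\in\mathcal{P}$ having a continuous density such that $\mathrm{supp}(\mu)\subset\mathrm{supp}(\mu_* )$ and $\mathcal{L}_S(\mu)<\mathcal{L}_S(\mu_* )$; and (2) there is no probability measure $\mu\in\mathcal{P}$ not having a continuous density such that $\mathrm{supp}(\mu)$ is contained in the interior of $\mathrm{supp}(\mu_* )$ and $\mathcal{L}_S(\mu)<\mathcal{L}_S(\mu_* )$.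
   Context: $\Theta=\mathbb{R}^d$, $\mathcal{X}\subset\mathbb{R}^n$ is Borel, $\mathcal{Y}=\{-1,1\}$; $h:\Theta\times\mathcal{X}\to[-1,1]$ is Borel measurable and continuous in $x$; $l:\mathbb{R}\to\mathbb{R}$ is a loss function. $S=\{(x_j,y_j)\}_{j=1}^N\subset\mathcal{X}\times\mathcal{Y}$ is a fixed finite dataset and $\mathbb{E}_S$ is the average over $S$ (in the variables $(x,y)$). $\mathcal{P}$ is the set of Borel probability measures on $\Theta$. For $\mu\in\mathcal{P}$, $h_\mu(x)=\mathbb{E}_{\theta\sim\mu}[h(\theta,x)]$, $\mathcal{L}_S(\mu)=\frac1N\sum_{j=1}^Nl(-y_jh_\mu(x_j))$, and $s_\mu(\theta,x,y)=-l'(-yh_\mu(x))\,y\,\nabla_\theta h(\theta,x)$. $\|\xi\|_{L^2(\mu)}^2=\mathbb{E}_\mu[\|\xi(\theta)\|_2^2]$. Densities are with respect to Lebesgue measure on $\mathbb{R}^d$.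
   Formalization: The support of μ_* is additionally required to be connected; for a disconnected support the claim fails, since h may be locally constant with different values on the components, so the score vanishes while moving mass lowers the loss. *)

theory Defs
  imports "HOL-Probability.Probability"
begin

definition supp :: "'a::topological_space measure \<Rightarrow> 'a set" where
  "supp \<mu> = {\<theta>. \<forall>U. open U \<longrightarrow> \<theta> \<in> U \<longrightarrow> 0 < emeasure \<mu> U}"

definition has_continuous_density :: "'a::euclidean_space measure \<Rightarrow> bool" where
  "has_continuous_density \<mu> \<longleftrightarrow>
     (\<exists>f. continuous_on UNIV f \<and> (\<forall>\<theta>. 0 \<le> f \<theta>) \<and> \<mu> = density lborel (\<lambda>\<theta>. ennreal (f \<theta>)))"

definition gradient :: "('a::real_inner \<Rightarrow> real) \<Rightarrow> 'a \<Rightarrow> 'a" where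
  "gradient f \<theta> = (THE D. GDERIV f \<theta> :> D)"

lemma gradient_eq: "GDERIV f \<theta> :> D \<Longrightarrow> gradient f \<theta> = D"
  unfolding gradient_def
proof (rule the_equality)
  fix D' assume "GDERIV f \<theta> :> D" "GDERIV f \<theta> :> D'"
  then have "(\<lambda>v. inner v D) = (\<lambda>v. inner v D')"
    unfolding gderiv_def by (rule has_derivative_unique)
  then have "\<forall>v. inner v D' = inner v D"
    by (simp add: fun_eq_iff)
  then show "D' = D"
    by (simp only: vector_eq_ldot)
qed

definition C1_function :: "('a::real_inner \<Rightarrow> real) \<Rightarrow> bool" where
  "C1_function f \<longleftrightarrow> (\<exists>G. (\<forall>\<theta>. GDERIV f \<theta> :> G \<theta>) \<and> continuous_on UNIV G)"

(* The Bochner integral is 0 for a non-integrable argument, so this is meaningful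
   only for square-integrable \<xi>.  It is used for continuous \<xi> and compactly supported \<mu>. *)
definition L2_norm_on :: "'a measure \<Rightarrow> ('a \<Rightarrow> 'b::real_normed_vector) \<Rightarrow> real" where
  "L2_norm_on \<mu> \<xi> = sqrt (LINT \<theta>|\<mu>. (norm (\<xi> \<theta>))\<^sup>2)"

(* C^k on an open set: all iterated directional derivatives up to order k exist,
   are Frechet differentiable below order k, and are continuous. *)
fun Ck_on :: "nat \<Rightarrow> 'a::euclidean_space set \<Rightarrow> ('a \<Rightarrow> 'b::euclidean_space) \<Rightarrow> bool" where
  "Ck_on 0 U f \<longleftrightarrow> continuous_on U f"
| "Ck_on (Suc k) U f \<longleftrightarrow>
     (\<forall>x\<in>U. f differentiable (at x)) \<and> (\<forall>v. Ck_on k U (\<lambda>x. frechet_derivative f (at x) v))"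

definition smooth_on :: "'a::euclidean_space set \<Rightarrow> ('a \<Rightarrow> 'b::euclidean_space) \<Rightarrow> bool" where
  "smooth_on U f \<longleftrightarrow> (\<forall>k. Ck_on k U f)"

(* Embedded k-dimensional smooth submanifold with (possibly empty) boundary: locally M is carried
   by a diffeomorphism of open sets of the ambient space onto a piece of a half-space of a
   k-dimensional linear subspace L.  For u = 0 the half-space is all of L. *)
definition smooth_submanifold_with_boundary :: "nat \<Rightarrow> 'a::euclidean_space set \<Rightarrow> bool" where
  "smooth_submanifold_with_boundary k M \<longleftrightarrow>
     (\<forall>p\<in>M. \<exists>U V \<phi> \<psi> L (u::'a).
        open U \<and> open V \<and> p \<in> U \<and>
        homeomorphism U V \<phi> \<psi> \<and> smooth_on U \<phi> \<and> smooth_on V \<psi> \<and>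
        subspace L \<and> dim L = k \<and> u \<in> L \<and>
        \<phi> ` (U \<inter> M) = V \<inter> {z \<in> L. 0 \<le> inner u z})"

(* Manifolds are understood to be connected.  Without this convention a support with several
   components would be allowed; h could then be locally constant on the support with different
   values on different components, so that the score vanishes on the support although moving
   mass between components decreases the loss. *)
definition compact_smooth_manifold_with_boundary :: "'a::euclidean_space set \<Rightarrow> bool" where
  "compact_smooth_manifold_with_boundary M \<longleftrightarrow>
     compact M \<and> connected M \<and> (\<exists>k. smooth_submanifold_with_boundary k M)"

definition h_avg :: "('a \<Rightarrow> 'x \<Rightarrow> real) \<Rightarrow> 'a measure \<Rightarrow> 'x \<Rightarrow> real" where
  "h_avg h \<mu> x = (LINT \<theta>|\<mu>. h \<theta> x)"

(* The dataset is the sequence of pairs (xs j, ys j), j = 1..N, so repetitions count. *)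
definition empirical_mean ::
    "nat \<Rightarrow> (nat \<Rightarrow> 'x) \<Rightarrow> (nat \<Rightarrow> real) \<Rightarrow> ('x \<Rightarrow> real \<Rightarrow> 'b::real_vector) \<Rightarrow> 'b" where
  "empirical_mean N xs ys F = (1 / real N) *\<^sub>R (\<Sum>j=1..N. F (xs j) (ys j))"

definition empirical_loss ::
    "('a \<Rightarrow> 'x \<Rightarrow> real) \<Rightarrow> (real \<Rightarrow> real) \<Rightarrow> nat \<Rightarrow> (nat \<Rightarrow> 'x) \<Rightarrow> (nat \<Rightarrow> real) \<Rightarrow> 'a measure \<Rightarrow> real" where
  "empirical_loss h l N xs ys \<mu> = (1 / real N) * (\<Sum>j=1..N. l (- ys j * h_avg h \<mu> (xs j)))"

definition score ::
    "('a::real_inner \<Rightarrow> 'x \<Rightarrow> real) \<Rightarrow> (real \<Rightarrow> real) \<Rightarrow> 'a measure \<Rightarrow> 'a \<Rightarrow> 'x \<Rightarrow> real \<Rightarrow> 'a" where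
  "score h l \<mu> \<theta> x y = (- deriv l (- y * h_avg h \<mu> x) * y) *\<^sub>R gradient (\<lambda>\<theta>'. h \<theta>' x) \<theta>"

end

theory Submission
  imports Defs
begin

text \<open>
  By convexity of \<open>l\<close>, \<open>L\<^sub>S(\<mu>) - L\<^sub>S(\<mu>\<^sub>*)\<close> is at least \<open>\<integral> F d\<mu> - \<integral> F d\<mu>\<^sub>*\<close>, where \<open>F\<close> is the
  potential \<open>F(\<theta>) = E\<^sub>S[- l'(- y h\<^sub>*(x)) y h(\<theta>,x)]\<close> with \<open>h\<^sub>*\<close> the average of \<open>h\<close> under \<open>\<mu>\<^sub>*\<close>,
  whose gradient is the averaged score. Stationarity and continuity make this gradient vanish
  on the whole support of \<open>\<mu>\<^sub>*\<close>. Critical points alone would not make \<open>F\<close> constant on a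
  connected set (Whitney's example), but in a boundary chart the support becomes convex, so \<open>F\<close>
  is locally constant on it, hence constant. Both integrals then equal that constant.
\<close>

text \<open>The complement of the support is a union of open null sets. Second countability lets the
  Lindelof property replace it by a countable union, which is still null.\<close>

lemma AE_in_supp:
  fixes \<mu> :: "'a::second_countable_topology measure"
  assumes sets: "sets \<mu> = sets borel"
  shows "AE \<theta> in \<mu>. \<theta> \<in> supp \<mu>"
proof -
  let ?\<U> = "{U. open U \<and> emeasure \<mu> U = 0}"
  obtain \<V> where \<V>: "\<V> \<subseteq> ?\<U>" "countable \<V>" "\<Union>\<V> = \<Union>?\<U>"
    using Lindelof[of ?\<U>] by auto
  have "(\<Union>U\<in>\<V>. U) \<in> null_sets \<mu>"
  proof (rule null_sets_UN')
    show "U \<in> null_sets \<mu>" if "U \<in> \<V>" for U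
      using that \<V>(1) sets by (auto intro!: null_setsI)
  qed (fact \<V>(2))
  moreover have "{\<theta> \<in> space \<mu>. \<theta> \<notin> supp \<mu>} \<subseteq> (\<Union>U\<in>\<V>. U)"
    using \<V>(3) unfolding supp_def by (auto simp: zero_less_iff_neq_zero)
  ultimately show ?thesis
    by (rule AE_I')
qed

text \<open>The set where \<open>g\<close> differs from \<open>c\<close> is open because points are
  closed in the codomain. If it contained a point of the support, it would have positive
  measure.\<close>

lemma AE_eq_imp_eq_on_supp:
  fixes g :: "'a::second_countable_topology \<Rightarrow> 'b::t1_space"
  assumes sets: "sets \<mu> = sets borel" and cont: "continuous_on UNIV g"
    and AE: "AE \<theta> in \<mu>. g \<theta> = c" and \<theta>: "\<theta> \<in> supp \<mu>"
  shows "g \<theta> = c"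
proof (rule ccontr)
  assume "g \<theta> \<noteq> c"
  moreover have op: "open {\<theta>. g \<theta> \<noteq> c}"
    using open_vimage[OF open_Compl[OF closed_singleton] cont, of c] by (simp add: vimage_def)
  ultimately have "0 < emeasure \<mu> {\<theta>. g \<theta> \<noteq> c}"
    using \<theta> unfolding supp_def by blast
  moreover have "{\<theta> \<in> space \<mu>. \<not> g \<theta> = c} = {\<theta>. g \<theta> \<noteq> c}"
    using sets_eq_imp_space_eq[OF sets] by auto
  then have "emeasure \<mu> {\<theta>. g \<theta> \<noteq> c} = 0"
    using AE_iff_measurable[of "{\<theta>. g \<theta> \<noteq> c}" \<mu> "\<lambda>\<theta>. g \<theta> = c"] AE sets op by auto
  ultimately show False
    by simp
qed

text \<open>Upgrades stationarity from an integral identity to a pointwise one. Compactness of the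
  support bounds the integrand almost everywhere, so it is integrable and the vanishing integral is
  not just the default value of the Bochner integral.\<close>

lemma L2_norm_on_eq_0_imp_eq_0_on_supp:
  fixes g :: "'a::euclidean_space \<Rightarrow> 'b::real_normed_vector"
  assumes sets: "sets \<mu> = sets borel" and fin: "finite_measure \<mu>"
    and cont: "continuous_on UNIV g" and comp: "compact (supp \<mu>)"
    and zero: "L2_norm_on \<mu> g = 0" and \<theta>: "\<theta> \<in> supp \<mu>"
  shows "g \<theta> = 0"
proof (rule AE_eq_imp_eq_on_supp[OF sets cont _ \<theta>])
  interpret finite_measure \<mu> by (fact fin)
  have cont2: "continuous_on UNIV (\<lambda>\<theta>. (norm (g \<theta>))\<^sup>2)"
    by (intro continuous_intros cont)
  have "bounded ((\<lambda>\<theta>. (norm (g \<theta>))\<^sup>2) ` supp \<mu>)"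
    by (intro compact_imp_bounded compact_continuous_image comp
        continuous_on_subset[OF cont2]) simp
  then obtain B where B: "\<And>\<theta>. \<theta> \<in> supp \<mu> \<Longrightarrow> norm ((norm (g \<theta>))\<^sup>2) \<le> B"
    unfolding bounded_iff by blast
  have "integrable \<mu> (\<lambda>\<theta>. (norm (g \<theta>))\<^sup>2)"
  proof (rule integrable_const_bound)
    show "AE \<theta> in \<mu>. norm ((norm (g \<theta>))\<^sup>2) \<le> B"
      using AE_in_supp[OF sets] by eventually_elim (rule B)
    show "(\<lambda>\<theta>. (norm (g \<theta>))\<^sup>2) \<in> borel_measurable \<mu>"
      using borel_measurable_continuous_onI[OF cont2]
      by (simp cong: measurable_cong_sets add: sets)
  qed
  moreover have "(LINT \<theta>|\<mu>. (norm (g \<theta>))\<^sup>2) = 0"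
    using zero by (simp add: L2_norm_on_def)
  ultimately have "AE \<theta> in \<mu>. (norm (g \<theta>))\<^sup>2 = 0"
    by (simp add: integral_nonneg_eq_0_iff_AE)
  then show "AE \<theta> in \<mu>. g \<theta> = 0"
    by simp
qed

lemma smooth_on_imp_differentiable: "smooth_on U f \<Longrightarrow> x \<in> U \<Longrightarrow> f differentiable (at x)"
  by (metis Ck_on.simps(2) smooth_on_def)

text \<open>The derivative of \<open>F\<close> is taken in the ambient space, so the chain rule with
  the inverse chart \<open>\<psi>\<close> applies at boundary points exactly as at interior
  ones.\<close>

lemma critical_imp_constant_on_manifold:
  fixes F :: "'a::euclidean_space \<Rightarrow> 'b::real_normed_vector"
  assumes man: "smooth_submanifold_with_boundary k M" and conn: "connected M"
    and crit: "\<And>\<theta>. \<theta> \<in> M \<Longrightarrow> (F has_derivative (\<lambda>v. 0)) (at \<theta>)"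
  shows "F constant_on M"
proof (rule locally_constant_imp_constant[OF conn])
  fix p assume p: "p \<in> M"
  obtain U V \<phi> \<psi> L and u :: 'a where U: "open U" and V: "open V" and pU: "p \<in> U"
    and hom: "homeomorphism U V \<phi> \<psi>" and smooth: "smooth_on V \<psi>" and L: "subspace L"
    and img: "\<phi> ` (U \<inter> M) = V \<inter> {z \<in> L. 0 \<le> inner u z}"
    using man p unfolding smooth_submanifold_with_boundary_def by metis
  have "\<phi> p \<in> V"
    using img p pU by blast
  then obtain e where e: "e > 0" "ball (\<phi> p) e \<subseteq> V"
    using V openE by blast
  \<comment> \<open>The ball keeps \<open>C\<close> inside the chart image, and its intersection
    with a half-space of \<open>L\<close> stays convex.\<close>
  define C where "C = ball (\<phi> p) e \<inter> (L \<inter> {z. 0 \<le> inner u z})"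
  have "convex C"
    unfolding C_def using L by (intro convex_Int convex_ball subspace_imp_convex convex_halfspace_ge) auto
  have C_M: "z \<in> V \<and> \<psi> z \<in> M" if "z \<in> C" for z
  proof -
    have "z \<in> \<phi> ` (U \<inter> M)"
      using that e img by (auto simp: C_def)
    then show ?thesis
      using hom that e by (auto simp: homeomorphism_def C_def)
  qed
  \<comment> \<open>\<open>C\<close> may have empty interior, so the derivative is computed in the
    ambient space and then restricted to \<open>C\<close>.\<close>
  have "((\<lambda>z. F (\<psi> z)) has_derivative (\<lambda>v. 0)) (at z within C)" if "z \<in> C" for z
  proof -
    have "\<psi> differentiable (at z)"
      using smooth_on_imp_differentiable[OF smooth] C_M[OF that] by blast
    then obtain D where "(\<psi> has_derivative D) (at z)"
      by (auto simp: differentiable_def)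
    then have "((\<lambda>z. F (\<psi> z)) has_derivative (\<lambda>v. 0)) (at z)"
      using has_derivative_compose[of \<psi> D z UNIV F "\<lambda>v. 0"] crit C_M[OF that] by simp
    then show ?thesis
      by (rule has_derivative_at_withinI)
  qed
  with \<open>convex C\<close> obtain c where c: "\<And>z. z \<in> C \<Longrightarrow> F (\<psi> z) = c"
    using has_derivative_zero_constant[of C "\<lambda>z. F (\<psi> z)"] by blast
  \<comment> \<open>Pulling the ball back along \<open>\<phi>\<close> gives an open neighbourhood of
    \<open>p\<close> whose points in \<open>M\<close> all land in \<open>C\<close>.\<close>
  define T where "T = U \<inter> \<phi> -` ball (\<phi> p) e"
  have "open T"
    unfolding T_def using hom U
    by (intro continuous_open_preimage) (auto simp: homeomorphism_def)
  have F_T: "F \<theta> = c" if "\<theta> \<in> M" "\<theta> \<in> T" for \<theta>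
  proof -
    have "\<phi> \<theta> \<in> C"
      using that img by (auto simp: C_def T_def)
    moreover have "\<psi> (\<phi> \<theta>) = \<theta>"
      using hom that by (auto simp: homeomorphism_def T_def)
    ultimately show ?thesis
      using c by metis
  qed
  show "\<exists>T. openin (top_of_set M) T \<and> p \<in> T \<and> (\<forall>x\<in>T. F x = F p)"
  proof (intro exI conjI)
    show "openin (top_of_set M) (M \<inter> T)"
      using \<open>open T\<close> by (rule openin_open_Int)
    show "p \<in> M \<inter> T"
      using p pU e by (simp add: T_def)
    then show "\<forall>x\<in>M \<inter> T. F x = F p"
      using F_T by simp
  qed
qed

lemma C1_function_GDERIV: "C1_function f \<Longrightarrow> GDERIV f \<theta> :> gradient f \<theta>"
  unfolding C1_function_def by (metis gradient_eq)

lemma C1_function_continuous_on_gradient: "C1_function f \<Longrightarrow> continuous_on UNIV (gradient f)"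
  unfolding C1_function_def by (metis gradient_eq ext)

lemma C1_function_continuous_on: "C1_function f \<Longrightarrow> continuous_on UNIV f"
  by (meson C1_function_GDERIV continuous_at_imp_continuous_on gderiv_def has_derivative_continuous)

text \<open>Sums the tangent line inequality of \<open>l\<close> at
  \<open>- y * h_avg h \<nu> x\<close> over the data. The two first-order means are kept apart
  because each is later evaluated as the integral of one potential.\<close>

lemma empirical_loss_above_tangent:
  assumes convex: "convex_on UNIV l" and C1: "l C1_differentiable_on UNIV"
  shows "empirical_loss h l N xs ys \<nu>
      + empirical_mean N xs ys (\<lambda>x y. - deriv l (- y * h_avg h \<nu> x) * y * h_avg h \<mu> x)
      - empirical_mean N xs ys (\<lambda>x y. - deriv l (- y * h_avg h \<nu> x) * y * h_avg h \<nu> x)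
    \<le> empirical_loss h l N xs ys \<mu>"
proof -
  have tangent: "deriv l b * (a - b) \<le> l a - l b" for a b
  proof (rule convex_on_imp_above_tangent[OF convex])
    have "l field_differentiable (at b)"
      using C1 by (simp add: C1_differentiable_on_eq real_differentiable_def field_differentiable_def
          has_real_derivative_iff_has_vector_derivative)
    then show "(l has_real_derivative deriv l b) (at b within UNIV)"
      by (simp add: field_differentiable_derivI)
  qed auto
  have "(\<Sum>j=1..N. - deriv l (- ys j * h_avg h \<nu> (xs j)) * ys j * h_avg h \<mu> (xs j))
      - (\<Sum>j=1..N. - deriv l (- ys j * h_avg h \<nu> (xs j)) * ys j * h_avg h \<nu> (xs j))
    = (\<Sum>j=1..N. deriv l (- ys j * h_avg h \<nu> (xs j)) *
        (- ys j * h_avg h \<mu> (xs j) - (- ys j * h_avg h \<nu> (xs j))))"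
    by (simp add: sum_subtractf[symmetric] algebra_simps)
  also have "\<dots> \<le> (\<Sum>j=1..N. l (- ys j * h_avg h \<mu> (xs j)) - l (- ys j * h_avg h \<nu> (xs j)))"
    by (intro sum_mono tangent)
  finally have "(1 / real N) * ((\<Sum>j=1..N. - deriv l (- ys j * h_avg h \<nu> (xs j)) * ys j * h_avg h \<mu> (xs j))
      - (\<Sum>j=1..N. - deriv l (- ys j * h_avg h \<nu> (xs j)) * ys j * h_avg h \<nu> (xs j)))
    \<le> (1 / real N) * ((\<Sum>j=1..N. l (- ys j * h_avg h \<mu> (xs j)))
      - (\<Sum>j=1..N. l (- ys j * h_avg h \<nu> (xs j))))"
    unfolding sum_subtractf by (rule mult_left_mono) simp
  then show ?thesis
    unfolding empirical_loss_def empirical_mean_def by (simp add: right_diff_distrib)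
qed

theorem theorem6:
  fixes X :: "(real ^ 'n) set"
    and h :: "real ^ 'd \<Rightarrow> real ^ 'n \<Rightarrow> real"
    and l :: "real \<Rightarrow> real"
    and N :: nat and xs :: "nat \<Rightarrow> real ^ 'n" and ys :: "nat \<Rightarrow> real"
    and \<mu>s :: "(real ^ 'd) measure"
  assumes X_borel: "X \<in> sets borel"
    and h_range: "\<And>\<theta> x. x \<in> X \<Longrightarrow> h \<theta> x \<in> {-1..1}"
    and h_meas: "(\<lambda>(\<theta>, x). h \<theta> x) \<in> borel_measurable (restrict_space borel (UNIV \<times> X))"
    and h_cont: "\<And>\<theta>. continuous_on X (h \<theta>)"
    and h_C1: "\<And>x. x \<in> X \<Longrightarrow> C1_function (\<lambda>\<theta>. h \<theta> x)"
    and l_C1: "l C1_differentiable_on UNIV"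
    and l_convex: "convex_on UNIV l"
    and N_pos: "N \<ge> 1"
    and data: "\<And>j. j \<in> {1..N} \<Longrightarrow> xs j \<in> X \<and> ys j \<in> {-1, 1}"
    and \<mu>s_prob: "\<mu>s \<in> space (prob_algebra borel)"
    and \<mu>s_density: "has_continuous_density \<mu>s"
    and \<mu>s_supp: "compact_smooth_manifold_with_boundary (supp \<mu>s)"
    and stationary: "L2_norm_on \<mu>s (\<lambda>\<theta>. empirical_mean N xs ys (\<lambda>x y. score h l \<mu>s \<theta> x y)) = 0"
  shows "(\<not> (\<exists>\<mu> \<in> space (prob_algebra (borel :: (real ^ 'd) measure)).
              has_continuous_density \<mu> \<and> supp \<mu> \<subseteq> supp \<mu>s \<and>
              empirical_loss h l N xs ys \<mu> < empirical_loss h l N xs ys \<mu>s)) \<and>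
         (\<not> (\<exists>\<mu> \<in> space (prob_algebra (borel :: (real ^ 'd) measure)).
              \<not> has_continuous_density \<mu> \<and> supp \<mu> \<subseteq> interior (supp \<mu>s) \<and>
              empirical_loss h l N xs ys \<mu> < empirical_loss h l N xs ys \<mu>s))"
proof -
  define M where "M = supp \<mu>s"
  \<comment> \<open>The weights are frozen at \<open>\<mu>s\<close>, so \<open>F\<close> is a fixed
    linear combination of the functions \<open>h \<theta> (xs j)\<close> and its gradient is the
    averaged score \<open>G\<close>.\<close>
  define c where "c x y = - deriv l (- y * h_avg h \<mu>s x) * y" for x y
  define F where "F \<theta> = empirical_mean N xs ys (\<lambda>x y. c x y * h \<theta> x)" for \<theta>
  define G where "G \<theta> = empirical_mean N xs ys (\<lambda>x y. score h l \<mu>s \<theta> x y)" for \<theta>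
  have C1: "C1_function (\<lambda>\<theta>. h \<theta> (xs j))" if "j \<in> {1..N}" for j
    using h_C1 data that by blast
  have sets_\<mu>s: "sets \<mu>s = sets borel" and prob_\<mu>s: "prob_space \<mu>s"
    using \<mu>s_prob by (auto simp: space_prob_algebra)
  have "compact M" "connected M"
    using \<mu>s_supp by (auto simp: compact_smooth_manifold_with_boundary_def M_def)
  obtain k where man: "smooth_submanifold_with_boundary k M"
    using \<mu>s_supp by (auto simp: compact_smooth_manifold_with_boundary_def M_def)

  have G_cont: "continuous_on UNIV G"
    unfolding G_def empirical_mean_def score_def
    by (intro continuous_intros C1_function_continuous_on_gradient C1)
  have G_zero: "G \<theta> = 0" if "\<theta> \<in> M" for \<theta>
  proof (rule L2_norm_on_eq_0_imp_eq_0_on_supp[OF sets_\<mu>s _ G_cont])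
    show "L2_norm_on \<mu>s G = 0"
      using stationary unfolding G_def[abs_def] .
  qed (use that prob_\<mu>s \<open>compact M\<close> in \<open>simp_all add: M_def prob_space.finite_measure\<close>)
  have F_deriv: "(F has_derivative (\<lambda>v. inner v (G \<theta>))) (at \<theta>)" for \<theta>
  proof -
    have "((\<lambda>\<theta>. h \<theta> (xs j)) has_derivative
        (\<lambda>v. inner v (gradient (\<lambda>\<theta>. h \<theta> (xs j)) \<theta>))) (at \<theta>)" if "j \<in> {1..N}" for j
      using C1_function_GDERIV[OF C1[OF that]] by (simp add: gderiv_def)
    then have "(F has_derivative (\<lambda>v. (1 / real N) *\<^sub>R (\<Sum>j=1..N. c (xs j) (ys j) *
        inner v (gradient (\<lambda>\<theta>. h \<theta> (xs j)) \<theta>)))) (at \<theta>)"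
      unfolding F_def empirical_mean_def
      by (intro has_derivative_scaleR_right has_derivative_sum has_derivative_mult_right)
    then show ?thesis
      by (simp add: G_def empirical_mean_def score_def c_def inner_sum_right)
  qed
  have "F constant_on M"
    using critical_imp_constant_on_manifold[OF man \<open>connected M\<close>, of F] F_deriv G_zero
    by (metis (no_types, lifting) ext inner_zero_right)
  then obtain a where F_const: "\<And>\<theta>. \<theta> \<in> M \<Longrightarrow> F \<theta> = a"
    unfolding constant_on_def by blast

  \<comment> \<open>Stated for every admissible \<open>\<mu>\<close> so that it also covers
    \<open>\<mu>s\<close> itself.\<close>
  have mean_const: "empirical_mean N xs ys (\<lambda>x y. c x y * h_avg h \<mu> x) = a"
    if \<mu>: "\<mu> \<in> space (prob_algebra borel)" and supp: "supp \<mu> \<subseteq> M" for \<mu>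
  proof -
    have sets: "sets \<mu> = sets borel" and "prob_space \<mu>"
      using \<mu> by (auto simp: space_prob_algebra)
    interpret prob_space \<mu> by fact
    \<comment> \<open>Integrability justifies exchanging the finite sum over the data with the
      integral, which turns the mean into the integral of \<open>F\<close>.\<close>
    have int: "integrable \<mu> (\<lambda>\<theta>. h \<theta> (xs j))" if "j \<in> {1..N}" for j
    proof (rule integrable_const_bound[where B = 1])
      show "AE \<theta> in \<mu>. norm (h \<theta> (xs j)) \<le> 1"
        using h_range data[OF that] by (auto simp: abs_le_iff)
      show "(\<lambda>\<theta>. h \<theta> (xs j)) \<in> borel_measurable \<mu>"
        using borel_measurable_continuous_onI[OF C1_function_continuous_on[OF C1[OF that]]]
        by (simp cong: measurable_cong_sets add: sets)
    qed
    have "empirical_mean N xs ys (\<lambda>x y. c x y * h_avg h \<mu> x) = (LINT \<theta>|\<mu>. F \<theta>)"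
      unfolding F_def empirical_mean_def h_avg_def
      using int by (simp add: Bochner_Integration.integral_sum)
    also have "\<dots> = (LINT \<theta>|\<mu>. a)"
    proof (rule integral_cong_AE)
      show "F \<in> borel_measurable \<mu>"
        using F_deriv
        by (simp cong: measurable_cong_sets add: sets)
          (meson borel_measurable_continuous_onI continuous_at_imp_continuous_on
            has_derivative_continuous)
      show "AE \<theta> in \<mu>. F \<theta> = a"
        using AE_in_supp[OF sets] by eventually_elim (use supp F_const in blast)
    qed simp
    finally show ?thesis
      by (simp add: prob_space)
  qed
  \<comment> \<open>Both first-order means equal \<open>a\<close> and cancel in the tangent bound.
    This one inequality serves both claims, since the interior of \<open>M\<close> lies in
    \<open>M\<close>.\<close>
  have "empirical_loss h l N xs ys \<mu>s \<le> empirical_loss h l N xs ys \<mu>"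
    if "\<mu> \<in> space (prob_algebra borel)" "supp \<mu> \<subseteq> M" for \<mu>
    using empirical_loss_above_tangent[OF l_convex l_C1, of h N xs ys \<mu>s \<mu>]
      mean_const[OF that] mean_const[OF \<mu>s_prob] by (simp add: c_def M_def)
  then show ?thesis
    using interior_subset[of M] unfolding M_def by (meson not_le subset_trans)
qed

end
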